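(* Let $\beta>0$ with $\beta\neq 1$, and let $R(\beta)\in(0,1)$ be the positive root of the equation $$\frac{3[1-(1-x)^{1-\beta}]}{1-\beta}-\frac{2[(1-x)^{-\beta}-1]}{\beta}=0 .$$ Then for every $f(z)=\sum_{n=0}^{\infty}a_nz^n\in\mathcal{B}$ and every $r$ with $0<r\le R(\beta)$, $$\sum_{n=0}^{\infty}\left(\frac{1}{n+1}\sum_{k=0}^{n}\frac{\Gamma(n-k+\beta)}{\Gamma(n-k+1)\,\Gamma(\beta)}\,|a_k|\right)r^n\le\frac{1}{r}\left[\frac{1-(1-r)^{1-\beta}}{1-\beta}\right].$$ Moreover, the radius $R(\beta)$ cannot be improved: there is no $R'\in(R(\beta),1)$ such that this inequality holds for all $f\in\mathcal{B}$ and all $0<r\le R'$.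
   Context: $\mathbb{D}=\{z\in\mathbb{C}:|z|<1\}$ is the open unit disk, and $\mathcal{B}$ is the set of all analytic functions $f$ on $\mathbb{D}$ with $|f(z)|\le 1$ for all $z\in\mathbb{D}$. $\Gamma$ is the Gamma function. *)

theory Defs
  imports "HOL-Complex_Analysis.Complex_Analysis"
begin

definition unit_ball_class :: "(complex \<Rightarrow> complex) set" where
  "unit_ball_class =
     {f. f analytic_on ball 0 1 \<and> (\<forall>z\<in>ball 0 1. norm (f z) \<le> 1)}"

definition power_series_on_disk :: "(complex \<Rightarrow> complex) \<Rightarrow> (nat \<Rightarrow> complex) \<Rightarrow> bool" where
  "power_series_on_disk f a \<longleftrightarrow> (\<forall>z\<in>ball 0 1. (\<lambda>n. a n * z ^ n) sums f z)"

definition beta_cesaro_coeff :: "real \<Rightarrow> (nat \<Rightarrow> complex) \<Rightarrow> nat \<Rightarrow> real" where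
  "beta_cesaro_coeff \<beta> a n =
     1 / (real n + 1) *
     (\<Sum>k\<le>n. Gamma (real (n - k) + \<beta>) / (Gamma (real (n - k) + 1) * Gamma \<beta>) * norm (a k))"

text \<open>
  The sum is a \<^const>\<open>suminf\<close>, so this is meaningful only where the series converges.
\<close>

definition bohr_cesaro_ineq :: "real \<Rightarrow> (nat \<Rightarrow> complex) \<Rightarrow> real \<Rightarrow> bool" where
  "bohr_cesaro_ineq \<beta> a r \<longleftrightarrow>
     (\<Sum>n. beta_cesaro_coeff \<beta> a n * r ^ n)
       \<le> 1 / r * ((1 - (1 - r) powr (1 - \<beta>)) / (1 - \<beta>))"

definition is_bohr_cesaro_radius :: "real \<Rightarrow> real \<Rightarrow> bool" where
  "is_bohr_cesaro_radius \<beta> x \<longleftrightarrow>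
     0 < x \<and> x < 1 \<and>
     3 * (1 - (1 - x) powr (1 - \<beta>)) / (1 - \<beta>) - 2 * ((1 - x) powr (- \<beta>) - 1) / \<beta> = 0"

end

(*
  Write G for the mean of (1 - x)^(-beta) over [0,r] and H for the mean of x (1 - x)^(-beta-1).
  Since |a_k| <= 1 - |a_0|^2 for k >= 1, the Cesaro sum is at most |a_0| G + (1 - |a_0|^2) H, and
  this is at most G for all |a_0| <= 1 as soon as 2 H <= G.  The radius R(beta) is the positive
  zero of r (G - 2 H), whose derivative (1 - r)^(-beta-1) (1 - 3 r) changes sign once.  The maps
  (t - z)/(1 - t z) with t -> 1 show that 2 H <= G is necessary.

  The coefficient bound reduces to k = 1: averaging f over the k-th roots of unity leaves a
  function of z^k with first coefficients a_0 and a_k, to which the Schwarz-Pick inequality at 0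
  applies.
*)
theory Submission imports Defs begin

section \<open>Weights of the Cesaro sum and their generating series\<close>

text \<open>These are the Taylor coefficients of \<open>(1 - x) powr (- b)\<close>. The Pochhammer
  form makes sense for every real \<open>b\<close>; below it is used also at
  \<open>\<beta> - 1\<close>, which may be negative.\<close>

definition cesaro_weight :: "real \<Rightarrow> nat \<Rightarrow> real" where
  "cesaro_weight b m = pochhammer b m / fact m"

lemma cesaro_weight_nonneg: "b > 0 \<Longrightarrow> 0 \<le> cesaro_weight b m"
  by (simp add: cesaro_weight_def pochhammer_pos less_imp_le)

lemma cesaro_weight_0 [simp]: "cesaro_weight b 0 = 1"
  by (simp add: cesaro_weight_def)

lemma cesaro_weight_Suc: "cesaro_weight s (Suc n) = s * cesaro_weight (s + 1) n / (real n + 1)"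
  by (simp add: cesaro_weight_def pochhammer_rec add.commute)

text \<open>Multiplying a generating function by 1/(1 - x) produces the partial sums of its
  coefficients, and turns the exponent -b into -b - 1.\<close>

lemma sum_cesaro_weight: "(\<Sum>k\<le>n. cesaro_weight b k) = cesaro_weight (b + 1) n"
proof (induction n)
  case (Suc n)
  have "fact n > (0::real)" by simp
  then show ?case
    using Suc unfolding sum.atMost_Suc
    by (simp add: cesaro_weight_def pochhammer_rec[of b] pochhammer_rec'[of "b + 1"] divide_simps)
       (simp add: algebra_simps)
qed simp

lemma cesaro_weight_Gamma:
  assumes "b > 0"
  shows "Gamma (real m + b) / (Gamma (real m + 1) * Gamma b) = cesaro_weight b m"
proof -
  have "b \<notin> \<int>\<^sub>\<le>\<^sub>0"
    using assms nonpos_Ints_nonpos by force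
  then have "pochhammer b m = Gamma (b + real m) / Gamma b"
    by (rule pochhammer_Gamma)
  moreover have "Gamma (real m + 1) = fact m"
    using Gamma_fact[of m] by (simp add: add.commute)
  ultimately show ?thesis
    by (simp add: cesaro_weight_def add.commute)
qed

lemma beta_cesaro_coeff_eq:
  assumes "\<beta> > 0"
  shows "beta_cesaro_coeff \<beta> a n = (\<Sum>k\<le>n. cesaro_weight \<beta> (n - k) * norm (a k)) / (real n + 1)"
  unfolding beta_cesaro_coeff_def cesaro_weight_Gamma[OF assms] by simp

text \<open>
  The limit is the mean of \<^term>\<open>(1 - x) powr (- s - 1)\<close> over the interval from 0 to r.
\<close>

lemma cesaro_weight_sums:
  assumes "s \<noteq> 0" "0 < r" "r < 1"
  shows "(\<lambda>n. cesaro_weight (s + 1) n / (real n + 1) * r ^ n) sums (1 / r * (((1 - r) powr (- s) - 1) / s))"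
proof -
  have "(\<lambda>n. ((- s) gchoose n) * (- r) ^ n) sums (1 + (- r)) powr (- s)"
    using assms by (intro gen_binomial_real) auto
  moreover have "((- s) gchoose n) * (- r) ^ n = cesaro_weight s n * r ^ n" for n
    unfolding gbinomial_pochhammer cesaro_weight_def power_minus[of r]
    by (cases "even n") auto
  ultimately have "(\<lambda>n. cesaro_weight s n * r ^ n) sums (1 - r) powr (- s)"
    by simp
  \<comment> \<open>Dropping the constant term and dividing by \<open>r * s\<close> replaces a
    termwise integration: by \<open>cesaro_weight_Suc\<close> the shift supplies both the parameter
    \<open>s + 1\<close> and the divisor n + 1.\<close>
  then have "(\<lambda>n. cesaro_weight s (Suc n) * r ^ Suc n) sums ((1 - r) powr (- s) - 1)"
    by (subst sums_Suc_iff) simp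
  then have "(\<lambda>n. cesaro_weight s (Suc n) * r ^ Suc n / (r * s)) sums (((1 - r) powr (- s) - 1) / (r * s))"
    by (rule sums_divide)
  moreover have "cesaro_weight s (Suc n) * r ^ Suc n / (r * s) = cesaro_weight (s + 1) n / (real n + 1) * r ^ n" for n
    using assms by (simp add: cesaro_weight_Suc)
  ultimately show ?thesis
    by (simp add: mult.commute)
qed

section \<open>Coefficient bounds for functions bounded by 1\<close>

text \<open>Schwarz-Pick at the origin: the disk automorphism taking w = \<open>g 0\<close> to 0 has
  derivative 1/(1 - |w|^2) at w, and the Schwarz lemma applies to its composition with
  \<open>g\<close>.\<close>

lemma deriv_0_le:
  assumes holo: "g holomorphic_on ball 0 1" and lt: "\<And>z. norm z < 1 \<Longrightarrow> norm (g z) < 1"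
  shows "norm (deriv g 0) \<le> 1 - (norm (g 0))\<^sup>2"
proof -
  define w where "w = g 0"
  have w: "norm w < 1" using lt[of 0] by (simp add: w_def)
  define \<phi> where "\<phi> = (\<lambda>z. Moebius_function 0 w (g z))"
  have hol: "\<phi> holomorphic_on ball 0 1"
    unfolding \<phi>_def
    using holomorphic_on_compose_gen[OF holo Moebius_function_holomorphic[OF w, of 0], unfolded o_def] lt
    by (simp add: image_subset_iff)
  have "norm (deriv \<phi> 0) \<le> 1"
  proof (rule Schwarz_Lemma(2)[OF hol])
    show "\<phi> 0 = 0" by (simp add: \<phi>_def w_def Moebius_function_eq_zero)
    show "norm (\<phi> z) < 1" if "norm z < 1" for z
      unfolding \<phi>_def by (intro Moebius_function_norm_lt_1 w lt that)
    show "norm (0::complex) < 1" by simp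
  qed
  have nw: "1 - cnj w * w = of_real (1 - (norm w)\<^sup>2)"
    using complex_norm_square[of w] by (simp add: mult.commute)
  have pos: "1 - (norm w)\<^sup>2 > 0"
    using w by (simp add: abs_square_less_1)
  then have nz: "1 - cnj w * w \<noteq> 0"
    unfolding nw by (metis of_real_eq_0_iff less_irrefl)
  have "(g has_field_derivative deriv g 0) (at 0)"
    using holo by (intro holomorphic_derivI[of _ "ball 0 1"]) auto
  then have "(\<phi> has_field_derivative (deriv g 0 / (1 - cnj w * w))) (at 0)"
    unfolding \<phi>_def Moebius_function_simple using nz
    by (auto intro!: derivative_eq_intros simp flip: w_def)
  then have "deriv \<phi> 0 = deriv g 0 / (1 - cnj w * w)"
    by (rule DERIV_imp_deriv)
  with \<open>norm (deriv \<phi> 0) \<le> 1\<close> have "norm (deriv g 0) / (1 - (norm w)\<^sup>2) \<le> 1"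
    using pos unfolding nw by (simp only: norm_divide norm_of_real abs_of_pos)
  with pos show ?thesis by (simp add: w_def)
qed

lemma first_coeff_bound:
  fixes c :: "nat \<Rightarrow> complex"
  assumes ser: "\<And>z. norm z < 1 \<Longrightarrow> (\<lambda>n. c n * z ^ n) sums h z"
    and le: "\<And>z. norm z < 1 \<Longrightarrow> norm (h z) \<le> 1"
  shows "norm (c 1) \<le> 1 - (norm (c 0))\<^sup>2"
proof -
  have hol: "h holomorphic_on ball 0 1"
    using ser by (intro power_series_holomorphic[of 0 1 c]) auto
  have h0: "h 0 = c 0"
    using ser[of 0] by (simp add: sums_iff powser_zero)
  have "((\<lambda>z. \<Sum>n. c n * z ^ n) has_field_derivative (\<Sum>n. diffs c n * 0 ^ n)) (at 0)"
    by (rule termdiffs_strong'[where K=1]) (auto intro: sums_summable[OF ser])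
  then have "((\<lambda>z. \<Sum>n. c n * z ^ n) has_field_derivative c 1) (at 0)"
    by (simp add: powser_zero diffs_def)
  then have "(h has_field_derivative c 1) (at 0)"
    by (rule has_field_derivative_transform_within_open[of _ _ _ "ball 0 1"])
       (use ser in \<open>auto simp: sums_iff\<close>)
  \<comment> \<open>Scaling by \<^term>\<open>t < 1\<close> gives the strict bound that the Schwarz lemma needs.\<close>
  have *: "t * norm (c 1) \<le> 1 - (t * norm (c 0))\<^sup>2" if t: "0 < t" "t < 1" for t
  proof -
    have "((\<lambda>z. of_real t * h z) has_field_derivative of_real t * c 1) (at 0)"
      using \<open>(h has_field_derivative c 1) (at 0)\<close> by (rule DERIV_cmult)
    then have d: "deriv (\<lambda>z. of_real t * h z) 0 = of_real t * c 1"
      by (rule DERIV_imp_deriv)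
    have "norm (deriv (\<lambda>z. of_real t * h z) 0) \<le> 1 - (norm (of_real t * h 0))\<^sup>2"
    proof (rule deriv_0_le)
      show "(\<lambda>z. of_real t * h z) holomorphic_on ball 0 1"
        by (intro holomorphic_intros hol)
      show "norm (of_real t * h z) < 1" if "norm z < 1" for z
      proof -
        have "t * norm (h z) \<le> t * 1"
          using t le[OF that] by (intro mult_left_mono) auto
        also have "\<dots> < 1" using t by simp
        finally show ?thesis using t by (simp add: norm_mult)
      qed
    qed
    then show ?thesis using t by (simp add: d h0 norm_mult)
  qed
  have "((\<lambda>t. t * norm (c 1)) \<longlongrightarrow> 1 * norm (c 1)) (at_left 1)"
    "((\<lambda>t. 1 - (t * norm (c 0))\<^sup>2) \<longlongrightarrow> 1 - (1 * norm (c 0))\<^sup>2) (at_left (1::real))"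
    by (intro tendsto_intros)+
  moreover have "eventually (\<lambda>t::real. t \<in> {0<..<1}) (at_left 1)"
    by (intro eventually_at_left_real) auto
  then have "eventually (\<lambda>t. t * norm (c 1) \<le> 1 - (t * norm (c 0))\<^sup>2) (at_left 1)"
    by eventually_elim (use * in auto)
  ultimately have "1 * norm (c 1) \<le> 1 - (1 * norm (c 0))\<^sup>2"
    by (intro tendsto_le[of "at_left (1::real)"]) auto
  then show ?thesis by simp
qed

text \<open>A geometric sum whose ratio has k-th power 1: it vanishes unless the ratio is itself 1,
  which happens exactly when \<open>k\<close> divides \<open>n\<close>.\<close>

lemma sum_powers_unity_root:
  fixes k n :: nat
  assumes "k \<ge> 1"
  defines "\<omega> \<equiv> cis (2 * pi / real k)"
  shows "(\<Sum>j<k. (\<omega> ^ n) ^ j) = (if k dvd n then of_nat k else 0)"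
proof -
  have "\<omega> ^ n = 1 \<longleftrightarrow> k dvd n"
    using complex_root_unity_eq_1[of k n] assms
    by (simp add: cis_conv_exp mult_ac flip: exp_of_nat_mult)
  moreover have "(\<omega> ^ n) ^ k = 1"
  proof -
    have "real k * (2 * pi / real k) = 2 * pi"
      using assms by simp
    then have "\<omega> ^ k = 1"
      unfolding \<omega>_def Complex.DeMoivre by simp
    then have "(\<omega> ^ k) ^ n = 1" by simp
    then show ?thesis
      by (simp only: mult.commute[of k] flip: power_mult)
  qed
  ultimately show ?thesis
    by (auto simp: geometric_sum)
qed

lemma coeff_bound:
  assumes f: "f \<in> unit_ball_class" and a: "power_series_on_disk f a" and k: "k \<ge> 1"
  shows "norm (a k) \<le> 1 - (norm (a 0))\<^sup>2"
proof -
  define \<omega> where "\<omega> = cis (2 * pi / real k)"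
  \<comment> \<open>The average keeps the bound 1 and retains only the coefficients whose index is a
    multiple of \<open>k\<close>.\<close>
  define A where "A = (\<lambda>z. (\<Sum>j<k. f (\<omega> ^ j * z)) / of_nat k)"
  have n\<omega>: "norm (\<omega> ^ j * z) = norm z" for j z
    by (simp add: \<omega>_def norm_mult norm_power)
  have A: "norm (A z) \<le> 1" and A_sums: "(\<lambda>n. a (k * n) * (z ^ k) ^ n) sums A z"
    if z: "norm z < 1" for z
  proof -
    have "norm (\<Sum>j<k. f (\<omega> ^ j * z)) \<le> (\<Sum>j<k. 1)"
      using f z n\<omega>[of _ z] by (intro sum_norm_le) (auto simp: unit_ball_class_def)
    then show "norm (A z) \<le> 1" using k by (simp add: A_def norm_divide)
    have "(\<lambda>n. (\<Sum>j<k. a n * (\<omega> ^ j * z) ^ n) / of_nat k) sums A z"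
      unfolding A_def
      by (intro sums_divide sums_sum) (use a z n\<omega>[of _ z] in \<open>auto simp: power_series_on_disk_def\<close>)
    moreover have "(\<Sum>j<k. a n * (\<omega> ^ j * z) ^ n) / of_nat k = (if k dvd n then a n * z ^ n else 0)" for n
    proof -
      have "(\<Sum>j<k. a n * (\<omega> ^ j * z) ^ n) = a n * z ^ n * (\<Sum>j<k. (\<omega> ^ n) ^ j)"
        by (simp add: sum_distrib_left power_mult_distrib mult_ac flip: power_mult)
      then show ?thesis
        using k sum_powers_unity_root[OF k, of n] by (simp add: \<omega>_def)
    qed
    ultimately have "(\<lambda>n. if k dvd n then a n * z ^ n else 0) sums A z"
      by simp
    \<comment> \<open>All terms outside the range of n -> k n are zero, so the series may be
      reindexed along that map.\<close>
    then have "(\<lambda>n. (\<lambda>n. if k dvd n then a n * z ^ n else 0) (k * n)) sums A z"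
      by (subst sums_mono_reindex) (use k in \<open>auto simp: strict_mono_def elim!: dvdE\<close>)
    then show "(\<lambda>n. a (k * n) * (z ^ k) ^ n) sums A z"
      by (simp add: power_mult)
  qed
  \<comment> \<open>\<open>A z\<close> depends only on \<open>z ^ k\<close>, and \<open>h\<close> is
    that dependence. Its first coefficient is \<open>a k\<close>.\<close>
  define h where "h = (\<lambda>w. \<Sum>n. a (k * n) * w ^ n)"
  have *: "(\<lambda>n. a (k * n) * w ^ n) sums h w \<and> norm (h w) \<le> 1" if w: "norm w < 1" for w
  proof -
    \<comment> \<open>A k-th root of \<open>w\<close> carries the facts about \<open>A\<close> over
      to \<open>h\<close>. The point 0 is separate because an exponential never vanishes.\<close>
    define z where "z = (if w = 0 then 0 else exp (Ln w / of_nat k))"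
    have z: "z ^ k = w"
      using k by (simp add: z_def flip: exp_of_nat_mult)
    then have "norm z ^ k < 1" using w by (simp flip: norm_power)
    then have "norm z < 1" using power_less_one_iff[of "norm z" k] by simp
    from A[OF this] A_sums[OF this] show ?thesis
      by (simp add: h_def z sums_iff)
  qed
  show ?thesis
    using first_coeff_bound[of "\<lambda>n. a (k * n)" h] * by simp
qed

section \<open>The sign of the left side of the radius equation\<close>

definition bohr_gap :: "real \<Rightarrow> real \<Rightarrow> real" where
  "bohr_gap \<beta> x = 3 * (1 - (1 - x) powr (1 - \<beta>)) / (1 - \<beta>) - 2 * ((1 - x) powr (- \<beta>) - 1) / \<beta>"

text \<open>The two terms contribute 3 (1 - x)^(-\<beta>) and -2 (1 - x)^(-\<beta>-1); taking out
  the lower power leaves 3 (1 - x) - 2 = 1 - 3x, so the only change of sign is at 1/3.\<close>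

lemma DERIV_bohr_gap:
  assumes "\<beta> > 0" "\<beta> \<noteq> 1" "x < 1"
  shows "(bohr_gap \<beta> has_real_derivative (1 - x) powr (- \<beta> - 1) * (1 - 3 * x)) (at x)"
proof -
  have "(1 - x) powr (- \<beta>) = (1 - x) powr (- \<beta> - 1) * (1 - x)"
    using assms powr_add[of "1 - x" "- \<beta> - 1" 1] by simp
  then show ?thesis
    unfolding bohr_gap_def [abs_def] using assms
    by (auto intro!: derivative_eq_intros simp: divide_simps) (simp add: algebra_simps)
qed

lemma continuous_on_bohr_gap:
  assumes "\<beta> > 0" "\<beta> \<noteq> 1" "S \<subseteq> {..<1}"
  shows "continuous_on S (bohr_gap \<beta>)"
  by (rule DERIV_continuous_on, rule has_field_derivative_at_within, rule DERIV_bohr_gap)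
     (use assms in auto)

lemma bohr_gap_0 [simp]: "bohr_gap \<beta> 0 = 0"
  by (simp add: bohr_gap_def)

text \<open>Near x = 1 the term with (1 - x)^(-\<beta>) dominates, and its coefficient is
  negative.\<close>

lemma bohr_gap_neg:
  assumes "\<beta> > 0" "\<beta> \<noteq> 1" "y < 1"
  obtains x where "y < x" "x < 1" "bohr_gap \<beta> x < 0"
proof -
  \<comment> \<open>This is \<open>t powr \<beta> * bohr_gap \<beta> (1 - t)\<close>: the factor
    removes the singularity at t = 0 and does not affect the sign.\<close>
  define H where "H = (\<lambda>t::real. 3 * (t powr \<beta> - t) / (1 - \<beta>) - 2 * (1 - t powr \<beta>) / \<beta>)"
  have "((\<lambda>t. t powr \<beta>) \<longlongrightarrow> 0) (at_right 0)"
    using assms by (intro tendsto_eq_intros) (auto simp: eventually_at_filter)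
  moreover have "((\<lambda>t. 3 * (u t - t) / (1 - \<beta>) - 2 * (1 - u t) / \<beta>) \<longlongrightarrow> - 2 / \<beta>) (at_right 0)"
    if "(u \<longlongrightarrow> 0) (at_right 0)" for u
    using assms that by (auto intro!: tendsto_eq_intros)
  ultimately have "(H \<longlongrightarrow> - 2 / \<beta>) (at_right 0)"
    unfolding H_def by blast
  then have "eventually (\<lambda>t. H t < 0) (at_right 0)"
    using assms by (intro order_tendstoD) auto
  moreover have "eventually (\<lambda>t. t \<in> {0<..<1 - y}) (at_right 0)"
    using assms by (intro eventually_at_right_real) auto
  ultimately have "eventually (\<lambda>t. H t < 0 \<and> t \<in> {0<..<1 - y}) (at_right 0)"
    by eventually_elim auto
  then obtain t where t: "H t < 0" "0 < t" "t < 1 - y"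
    by (auto dest!: eventually_happens)
  have "bohr_gap \<beta> (1 - t) = t powr (- \<beta>) * H t"
    using t assms unfolding bohr_gap_def H_def
    by (simp add: powr_diff powr_minus field_simps)
  then have "bohr_gap \<beta> (1 - t) < 0"
    using t by (simp add: mult_pos_neg)
  then show ?thesis
    using t by (intro that[of "1 - t"]) auto
qed

lemma bohr_gap_less_left:
  assumes "\<beta> > 0" "\<beta> \<noteq> 1" "0 \<le> x" "x < y" "y \<le> 1/3"
  shows "bohr_gap \<beta> x < bohr_gap \<beta> y"
\<comment> \<open>Only interior points are tested, since the derivative vanishes at 1/3.\<close>
proof (rule DERIV_pos_imp_increasing_open[OF \<open>x < y\<close>])
  show "\<exists>d. (bohr_gap \<beta> has_real_derivative d) (at z) \<and> d > 0" if "x < z" "z < y" for z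
    by (intro exI[of _ "(1 - z) powr (- \<beta> - 1) * (1 - 3 * z)"] conjI DERIV_bohr_gap mult_pos_pos)
       (use assms that in auto)
  show "continuous_on {x..y} (bohr_gap \<beta>)"
    using assms by (intro continuous_on_bohr_gap) auto
qed

lemma bohr_gap_less_right:
  assumes "\<beta> > 0" "\<beta> \<noteq> 1" "1/3 \<le> x" "x < y" "y < 1"
  shows "bohr_gap \<beta> y < bohr_gap \<beta> x"
proof (rule DERIV_neg_imp_decreasing_open[OF \<open>x < y\<close>])
  show "\<exists>d. (bohr_gap \<beta> has_real_derivative d) (at z) \<and> d < 0" if "x < z" "z < y" for z
    by (intro exI[of _ "(1 - z) powr (- \<beta> - 1) * (1 - 3 * z)"] conjI DERIV_bohr_gap mult_pos_neg)
       (use assms that in auto)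
  show "continuous_on {x..y} (bohr_gap \<beta>)"
    using assms by (intro continuous_on_bohr_gap) auto
qed

lemma is_bohr_cesaro_radius_iff:
  "is_bohr_cesaro_radius \<beta> x \<longleftrightarrow> 0 < x \<and> x < 1 \<and> bohr_gap \<beta> x = 0"
  by (simp add: is_bohr_cesaro_radius_def bohr_gap_def)

text \<open>The gap climbs from 0 at the origin to a positive value at 1/3 and is negative somewhere
  closer to 1, so the intermediate value theorem gives a zero.\<close>

lemma bohr_radius_exists:
  assumes "\<beta> > 0" "\<beta> \<noteq> 1"
  obtains R where "is_bohr_cesaro_radius \<beta> R"
proof -
  obtain x where x: "1/3 < x" "x < 1" "bohr_gap \<beta> x < 0"
    using bohr_gap_neg[OF assms, of "1/3"] by auto
  have "bohr_gap \<beta> (1/3) > 0"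
    using bohr_gap_less_left[OF assms, of 0 "1/3"] by simp
  moreover have "continuous_on {1/3..x} (bohr_gap \<beta>)"
    using assms x by (intro continuous_on_bohr_gap) auto
  ultimately obtain R where "1/3 \<le> R" "R \<le> x" "bohr_gap \<beta> R = 0"
    using IVT2'[of "bohr_gap \<beta>" x 0 "1/3"] x by auto
  then show ?thesis
    using x that[of R] by (simp add: is_bohr_cesaro_radius_iff)
qed

text \<open>The positive side serves the inequality, the negative side its sharpness, and the two
  together the uniqueness of the radius.\<close>

lemma bohr_radius_sign:
  assumes "\<beta> > 0" "\<beta> \<noteq> 1" "is_bohr_cesaro_radius \<beta> R"
  shows "0 < x \<Longrightarrow> x < R \<Longrightarrow> bohr_gap \<beta> x > 0" and "R < x \<Longrightarrow> x < 1 \<Longrightarrow> bohr_gap \<beta> x < 0"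
proof -
  have R: "0 < R" "R < 1" "bohr_gap \<beta> R = 0"
    using assms by (auto simp: is_bohr_cesaro_radius_iff)
  \<comment> \<open>Up to 1/3 the gap strictly exceeds its value 0 at the origin, so no zero lies
    there.\<close>
  have R3: "R > 1/3"
    using bohr_gap_less_left[OF assms(1,2), of 0 R] R by fastforce
  show "bohr_gap \<beta> x > 0" if "0 < x" "x < R"
    using bohr_gap_less_left[OF assms(1,2), of 0 x] bohr_gap_less_right[OF assms(1,2), of x R] R that
    by (cases "x \<le> 1/3") auto
  show "bohr_gap \<beta> x < 0" if "R < x" "x < 1"
    using bohr_gap_less_right[OF assms(1,2), of R x] R R3 that by auto
qed

lemma bohr_radius_unique:
  assumes "\<beta> > 0" "\<beta> \<noteq> 1"
  shows "\<exists>!R. is_bohr_cesaro_radius \<beta> R"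
proof -
  obtain R where R: "is_bohr_cesaro_radius \<beta> R"
    using bohr_radius_exists[OF assms] .
  show ?thesis
  proof (rule ex1I)
    show "is_bohr_cesaro_radius \<beta> R" by (rule R)
    fix S assume "is_bohr_cesaro_radius \<beta> S"
    then show "S = R"
      using bohr_radius_sign[OF assms R, of S]
      by (cases S R rule: linorder_cases) (auto simp: is_bohr_cesaro_radius_iff)
  qed
qed

section \<open>The majorant and the Bohr inequality\<close>

definition head_sum :: "real \<Rightarrow> real \<Rightarrow> real" where
  "head_sum \<beta> r = 1 / r * ((1 - (1 - r) powr (1 - \<beta>)) / (1 - \<beta>))"

text \<open>\<open>head_sum\<close> and \<open>tail_sum\<close> are the means G and H of the opening
  comment. The first term here is the mean of (1 - x)^(-\<beta>-1), and (1 - x)^(-\<beta>-1) - (1 -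
  x)^(-\<beta>) = x (1 - x)^(-\<beta>-1).\<close>

definition tail_sum :: "real \<Rightarrow> real \<Rightarrow> real" where
  "tail_sum \<beta> r = 1 / r * (((1 - r) powr (- \<beta>) - 1) / \<beta>) - head_sum \<beta> r"

lemma bohr_cesaro_ineq_iff:
  "bohr_cesaro_ineq \<beta> a r \<longleftrightarrow> (\<Sum>n. beta_cesaro_coeff \<beta> a n * r ^ n) \<le> head_sum \<beta> r"
  unfolding bohr_cesaro_ineq_def head_sum_def ..

lemma bohr_gap_eq:
  assumes "r > 0"
  shows "bohr_gap \<beta> r = r * (head_sum \<beta> r - 2 * tail_sum \<beta> r)"
proof -
  \<comment> \<open>\<open>G\<close> and \<open>K\<close> stand for the integrals before division by
    \<open>r\<close>.\<close>
  have "3 * G - 2 * K = r * (1 / r * G - 2 * (1 / r * K - 1 / r * G))" for G K :: real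
    using assms by (simp add: field_simps)
  then show ?thesis
    unfolding bohr_gap_def tail_sum_def head_sum_def times_divide_eq_right[of 3 , symmetric]
      times_divide_eq_right[of 2, symmetric] .
qed

lemma head_sum_sums:
  assumes "\<beta> \<noteq> 1" "0 < r" "r < 1"
  shows "(\<lambda>n. cesaro_weight \<beta> n / (real n + 1) * r ^ n) sums head_sum \<beta> r"
proof -
  \<comment> \<open>The parameter is s = \<beta> - 1; numerator and denominator both change
    sign.\<close>
  have "1 / r * (((1 - r) powr (- (\<beta> - 1)) - 1) / (\<beta> - 1)) = head_sum \<beta> r"
    using assms by (simp add: head_sum_def divide_simps) (simp add: algebra_simps)
  then show ?thesis
    using cesaro_weight_sums[of "\<beta> - 1" r] assms by simp
qed

lemma sum_cesaro_weight_tail: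
  "(\<Sum>k=1..n. cesaro_weight b (n - k)) = cesaro_weight (b + 1) n - cesaro_weight b n"
proof -
  have "(\<Sum>k\<le>n. cesaro_weight b (n - k)) = cesaro_weight (b + 1) n"
    using sum_cesaro_weight[of b n] sum.nat_diff_reindex[of "cesaro_weight b" "Suc n"]
    by (simp add: lessThan_Suc_atMost)
  then show ?thesis
    by (simp add: atMost_atLeast0 sum.atLeast_Suc_atMost)
qed

lemma tail_sum_sums:
  assumes "\<beta> > 0" "\<beta> \<noteq> 1" "0 < r" "r < 1"
  shows "(\<lambda>n. (\<Sum>k=1..n. cesaro_weight \<beta> (n - k)) / (real n + 1) * r ^ n) sums tail_sum \<beta> r"
  using sums_diff[OF cesaro_weight_sums[of \<beta> r] head_sum_sums[of \<beta> r]] assms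
  unfolding tail_sum_def sum_cesaro_weight_tail by (simp add: diff_divide_distrib left_diff_distrib)

lemma tail_sum_nonneg:
  assumes "\<beta> > 0" "\<beta> \<noteq> 1" "0 < r" "r < 1"
  shows "tail_sum \<beta> r \<ge> 0"
  by (rule sums_le[OF _ sums_zero tail_sum_sums[OF assms]])
     (use assms in \<open>auto intro!: mult_nonneg_nonneg divide_nonneg_pos sum_nonneg cesaro_weight_nonneg\<close>)

lemma beta_cesaro_coeff_split:
  assumes "\<beta> > 0"
  shows "beta_cesaro_coeff \<beta> a n =
    (cesaro_weight \<beta> n * norm (a 0) + (\<Sum>k=1..n. cesaro_weight \<beta> (n - k) * norm (a k))) / (real n + 1)"
  by (simp add: beta_cesaro_coeff_eq[OF assms] atMost_atLeast0 sum.atLeast_Suc_atMost)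

lemma beta_cesaro_coeff_nonneg: "\<beta> > 0 \<Longrightarrow> beta_cesaro_coeff \<beta> a n \<ge> 0"
  by (simp add: beta_cesaro_coeff_eq sum_nonneg cesaro_weight_nonneg)

text \<open>The terms with k = 0 add up to \<alpha> G, and \<open>coeff_bound\<close> bounds the
  remaining ones by (1 - \<alpha>^2) H. The same comparison gives summability, without which the
  \<open>suminf\<close> would say nothing.\<close>

lemma bohr_cesaro_majorant:
  assumes \<beta>: "\<beta> > 0" "\<beta> \<noteq> 1" and r: "0 < r" "r < 1"
    and a: "f \<in> unit_ball_class" "power_series_on_disk f a"
  defines "\<alpha> \<equiv> norm (a 0)"
  shows "summable (\<lambda>n. beta_cesaro_coeff \<beta> a n * r ^ n)"
    and "(\<Sum>n. beta_cesaro_coeff \<beta> a n * r ^ n) \<le> \<alpha> * head_sum \<beta> r + (1 - \<alpha>\<^sup>2) * tail_sum \<beta> r"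
proof -
  define M where "M = (\<lambda>n. \<alpha> * (cesaro_weight \<beta> n / (real n + 1) * r ^ n) +
    (1 - \<alpha>\<^sup>2) * ((\<Sum>k=1..n. cesaro_weight \<beta> (n - k)) / (real n + 1) * r ^ n))"
  have M: "M sums (\<alpha> * head_sum \<beta> r + (1 - \<alpha>\<^sup>2) * tail_sum \<beta> r)"
    unfolding M_def by (intro sums_add sums_mult head_sum_sums tail_sum_sums \<beta> r)
  have le: "beta_cesaro_coeff \<beta> a n * r ^ n \<le> M n" for n
  proof -
    have "(\<Sum>k=1..n. cesaro_weight \<beta> (n - k) * norm (a k)) \<le> (\<Sum>k=1..n. cesaro_weight \<beta> (n - k) * (1 - \<alpha>\<^sup>2))"
      unfolding \<alpha>_def by (intro sum_mono mult_left_mono coeff_bound[OF a] cesaro_weight_nonneg \<beta>) auto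
    also have "\<dots> = (1 - \<alpha>\<^sup>2) * (\<Sum>k=1..n. cesaro_weight \<beta> (n - k))"
      by (simp add: sum_distrib_left mult.commute)
    finally have "beta_cesaro_coeff \<beta> a n * r ^ n \<le>
       (cesaro_weight \<beta> n * \<alpha> + (1 - \<alpha>\<^sup>2) * (\<Sum>k=1..n. cesaro_weight \<beta> (n - k))) / (real n + 1) * r ^ n"
      unfolding beta_cesaro_coeff_split[OF \<beta>(1)] \<alpha>_def[symmetric]
      using r by (intro mult_right_mono divide_right_mono add_left_mono) auto
    also have "\<dots> = M n"
      by (simp add: M_def divide_inverse algebra_simps)
    finally show ?thesis .
  qed
  show summ: "summable (\<lambda>n. beta_cesaro_coeff \<beta> a n * r ^ n)"
    by (rule summable_comparison_test'[OF sums_summable[OF M], of 0])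
       (use le r beta_cesaro_coeff_nonneg[OF \<beta>(1)] in \<open>auto simp: abs_mult\<close>)
  show "(\<Sum>n. beta_cesaro_coeff \<beta> a n * r ^ n) \<le> \<alpha> * head_sum \<beta> r + (1 - \<alpha>\<^sup>2) * tail_sum \<beta> r"
    using sums_le[OF le summable_sums[OF summ] M] .
qed

text \<open>The slack in the majorant is G - \<alpha> G - (1 - \<alpha>^2) H = (1 - \<alpha>) (G -
  (1 + \<alpha>) H), which is nonnegative because 1 + \<alpha> \<le> 2 and 2 H \<le> G.\<close>

lemma bohr_cesaro_ineq_holds:
  assumes \<beta>: "\<beta> > 0" "\<beta> \<noteq> 1" and r: "0 < r" "r < 1" and gap: "bohr_gap \<beta> r \<ge> 0"
    and a: "f \<in> unit_ball_class" "power_series_on_disk f a"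
  shows "bohr_cesaro_ineq \<beta> a r"
proof -
  define \<alpha> where "\<alpha> = norm (a 0)"
  have "a 0 = f 0"
    using a(2) by (auto simp: power_series_on_disk_def sums_iff powser_zero dest!: bspec[of _ _ 0])
  then have \<alpha>: "0 \<le> \<alpha>" "\<alpha> \<le> 1"
    using a(1) by (auto simp: unit_ball_class_def \<alpha>_def)
  have "2 * tail_sum \<beta> r \<le> head_sum \<beta> r"
    using gap r by (simp add: bohr_gap_eq zero_le_mult_iff)
  moreover have "(1 + \<alpha>) * tail_sum \<beta> r \<le> 2 * tail_sum \<beta> r"
    using \<alpha> tail_sum_nonneg[OF \<beta> r] by (intro mult_right_mono) auto
  ultimately have "(1 - \<alpha>) * ((1 + \<alpha>) * tail_sum \<beta> r) \<le> (1 - \<alpha>) * head_sum \<beta> r"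
    using \<alpha> by (intro mult_left_mono) auto
  then have "\<alpha> * head_sum \<beta> r + (1 - \<alpha>\<^sup>2) * tail_sum \<beta> r \<le> head_sum \<beta> r"
    by (simp add: algebra_simps power2_eq_square)
  with bohr_cesaro_majorant(2)[OF \<beta> r a] show ?thesis
    by (simp add: bohr_cesaro_ineq_iff \<alpha>_def)
qed

section \<open>Extremal functions and sharpness\<close>

definition blaschke_coeff :: "real \<Rightarrow> nat \<Rightarrow> complex" where
  "blaschke_coeff t n = (if n = 0 then of_real t else of_real (- (1 - t\<^sup>2) * t ^ (n - 1)))"

lemma blaschke_coeff_norm:
  assumes "0 \<le> t" "t < 1"
  shows "norm (blaschke_coeff t n) = (if n = 0 then t else (1 - t\<^sup>2) * t ^ (n - 1))"
proof -
  have "1 - t\<^sup>2 \<ge> 0" using assms by (simp add: abs_square_le_1)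
  then show ?thesis
    using assms unfolding blaschke_coeff_def by (simp only: norm_of_real abs_mult abs_minus power_abs abs_of_nonneg split: if_split) simp
qed

text \<open>The minus sign turns the library map (z - t)/(1 - t z) into (t - z)/(1 - t z) = t - (1 -
  t^2) z/(1 - t z), whose last fraction expands as a geometric series.\<close>

lemma blaschke_extremal:
  assumes "0 \<le> t" "t < 1"
  defines "f \<equiv> \<lambda>z. - Moebius_function 0 (of_real t) z"
  shows "f \<in> unit_ball_class" "power_series_on_disk f (blaschke_coeff t)"
proof -
  have t: "norm (of_real t :: complex) < 1" using assms by simp
  show "f \<in> unit_ball_class"
    unfolding unit_ball_class_def f_def
    using Moebius_function_norm_lt_1[OF t, of _ 0]
    by (auto simp: analytic_on_open less_imp_le intro!: holomorphic_intros Moebius_function_holomorphic t)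
  show "power_series_on_disk f (blaschke_coeff t)"
    unfolding power_series_on_disk_def
  proof
    fix z :: complex assume "z \<in> ball 0 1"
    then have "norm z < 1" by simp
    then have tz: "norm (of_real t * z) < 1"
      using assms mult_strict_mono'[of t 1 "norm z" 1] by (simp add: norm_mult)
    then have nz: "1 - of_real t * z \<noteq> 0" by auto
    have "(\<lambda>n. - (1 - of_real t ^ 2) * z * (of_real t * z) ^ n) sums
        (- (1 - of_real t ^ 2) * z * (1 / (1 - of_real t * z)))"
      by (intro sums_mult geometric_sums tz)
    then have "(\<lambda>n. blaschke_coeff t (Suc n) * z ^ Suc n) sums
        (- (1 - of_real t ^ 2) * z * (1 / (1 - of_real t * z)))"
      by (simp add: blaschke_coeff_def power_mult_distrib mult_ac)
    then have "(\<lambda>n. blaschke_coeff t n * z ^ n) sums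
        (- (1 - of_real t ^ 2) * z * (1 / (1 - of_real t * z)) + blaschke_coeff t 0 * z ^ 0)"
      by (subst (asm) sums_Suc_iff) simp
    moreover have "- (1 - of_real t ^ 2) * z * (1 / (1 - of_real t * z)) + blaschke_coeff t 0 * z ^ 0 = f z"
      using nz by (simp add: f_def Moebius_function_simple blaschke_coeff_def field_simps power2_eq_square)
    ultimately show "(\<lambda>n. blaschke_coeff t n * z ^ n) sums f z" by simp
  qed
qed

text \<open>For these functions the Cesaro sum is exactly t G + (1 - t^2) B(t) with B(t) a series of
  nonnegative terms. The inequality then reads (1 + t) B(t) \<le> G after cancelling 1 - t, and B(t)
  becomes H at t = 1.\<close>

lemma bohr_cesaro_ineq_sharp:
  assumes \<beta>: "\<beta> > 0" "\<beta> \<noteq> 1" and r: "0 < r" "r < 1"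
    and ineq: "\<And>t. 0 \<le> t \<Longrightarrow> t < 1 \<Longrightarrow> bohr_cesaro_ineq \<beta> (blaschke_coeff t) r"
  shows "bohr_gap \<beta> r \<ge> 0"
proof -
  \<comment> \<open>Truncations are polynomials in t, so t can tend to 1 without uniform convergence.\<close>
  define P where "P = (\<lambda>N t. \<Sum>n<N. (\<Sum>k=1..n. cesaro_weight \<beta> (n - k) * t ^ (k - 1)) / (real n + 1) * r ^ n)"
  have *: "(1 + t) * P N t \<le> head_sum \<beta> r" if t: "0 \<le> t" "t < 1" for t N
  proof -
    define b where "b = (\<lambda>n. (\<Sum>k=1..n. cesaro_weight \<beta> (n - k) * t ^ (k - 1)) / (real n + 1) * r ^ n)"
    have t2: "1 - t\<^sup>2 > 0" using t by (simp add: abs_square_less_1)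
    have coeff: "beta_cesaro_coeff \<beta> (blaschke_coeff t) n * r ^ n =
        t * (cesaro_weight \<beta> n / (real n + 1) * r ^ n) + (1 - t\<^sup>2) * b n" for n
    proof -
      have "(\<Sum>k=1..n. cesaro_weight \<beta> (n - k) * norm (blaschke_coeff t k)) =
          (\<Sum>k=1..n. (1 - t\<^sup>2) * (cesaro_weight \<beta> (n - k) * t ^ (k - 1)))"
        using t t2 by (intro sum.cong) (simp_all add: blaschke_coeff_norm)
      also have "\<dots> = (1 - t\<^sup>2) * (\<Sum>k=1..n. cesaro_weight \<beta> (n - k) * t ^ (k - 1))"
        by (simp only: sum_distrib_left)
      finally have S: "(\<Sum>k=1..n. cesaro_weight \<beta> (n - k) * norm (blaschke_coeff t k)) = \<dots>" .
      have "norm (blaschke_coeff t 0) = t"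
        using t by (simp add: blaschke_coeff_norm)
      then show ?thesis
        unfolding beta_cesaro_coeff_split[OF \<beta>(1)] S b_def
        by (simp add: divide_inverse ring_distribs mult_ac)
    qed
    have summ: "summable (\<lambda>n. beta_cesaro_coeff \<beta> (blaschke_coeff t) n * r ^ n)"
      using bohr_cesaro_majorant(1)[OF \<beta> r blaschke_extremal[OF t]] .
    have "(\<lambda>n. (1 - t\<^sup>2) * b n) sums
        ((\<Sum>n. beta_cesaro_coeff \<beta> (blaschke_coeff t) n * r ^ n) - t * head_sum \<beta> r)"
      using sums_diff[OF summable_sums[OF summ] sums_mult[OF head_sum_sums[OF \<beta>(2) r], of t]]
      by (simp only: coeff add_diff_cancel_left')
    moreover have "(1 - t\<^sup>2) * b n \<ge> 0" for n
      unfolding b_def using t t2 r \<beta>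
      by (intro mult_nonneg_nonneg divide_nonneg_pos sum_nonneg cesaro_weight_nonneg) auto
    \<comment> \<open>Nonnegative terms allow the full sum to be replaced by any partial
      sum.\<close>
    ultimately have "(\<Sum>n<N. (1 - t\<^sup>2) * b n) \<le>
        (\<Sum>n. beta_cesaro_coeff \<beta> (blaschke_coeff t) n * r ^ n) - t * head_sum \<beta> r"
      using sum_le_suminf[of "\<lambda>n. (1 - t\<^sup>2) * b n" "{..<N}"] by (simp add: sums_iff)
    also have "\<dots> \<le> (1 - t) * head_sum \<beta> r"
      using ineq[OF t] by (simp add: bohr_cesaro_ineq_iff algebra_simps)
    also have "(\<Sum>n<N. (1 - t\<^sup>2) * b n) = (1 - t\<^sup>2) * P N t"
      unfolding P_def b_def by (simp only: sum_distrib_left)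
    also have "\<dots> = (1 - t) * ((1 + t) * P N t)"
      by (simp add: power2_eq_square algebra_simps)
    finally have "(1 - t) * ((1 + t) * P N t) \<le> (1 - t) * head_sum \<beta> r" .
    then show ?thesis using t by simp
  qed
  \<comment> \<open>First t -> 1 with \<open>N\<close> fixed, then N -> infinity:
    \<open>P N 1\<close> is the N-th partial sum of the series for \<open>tail_sum\<close>.\<close>
  have "2 * P N 1 \<le> head_sum \<beta> r" for N
  proof (rule tendsto_upperbound)
    show "((\<lambda>t. (1 + t) * P N t) \<longlongrightarrow> 2 * P N 1) (at_left 1)"
      unfolding P_def by (auto intro!: tendsto_eq_intros)
    show "eventually (\<lambda>t. (1 + t) * P N t \<le> head_sum \<beta> r) (at_left 1)"
      using eventually_at_left_real[of 0 "1::real"] by (auto elim!: eventually_mono intro!: *)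
  qed simp
  moreover have "(\<lambda>N. 2 * P N 1) \<longlonglongrightarrow> 2 * tail_sum \<beta> r"
    using tail_sum_sums[OF \<beta> r] by (auto simp: sums_def P_def intro!: tendsto_intros)
  ultimately have "2 * tail_sum \<beta> r \<le> head_sum \<beta> r"
    using LIMSEQ_le_const2 by metis
  then show ?thesis
    using r by (simp add: bohr_gap_eq)
qed

theorem theorem2p1:
  fixes \<beta> :: real
  assumes "\<beta> > 0" and "\<beta> \<noteq> 1"
  shows "(\<exists>!R. is_bohr_cesaro_radius \<beta> R) \<and>
    (\<forall>f\<in>unit_ball_class. \<forall>a. power_series_on_disk f a \<longrightarrow>
       (\<forall>r. 0 < r \<and> r < 1 \<longrightarrow> summable (\<lambda>n. beta_cesaro_coeff \<beta> a n * r ^ n))) \<and>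
    (\<forall>R. is_bohr_cesaro_radius \<beta> R \<longrightarrow>
       (\<forall>f\<in>unit_ball_class. \<forall>a. power_series_on_disk f a \<longrightarrow>
          (\<forall>r. 0 < r \<and> r \<le> R \<longrightarrow> bohr_cesaro_ineq \<beta> a r)) \<and>
       \<not> (\<exists>R'. R < R' \<and> R' < 1 \<and>
            (\<forall>f\<in>unit_ball_class. \<forall>a. power_series_on_disk f a \<longrightarrow>
               (\<forall>r. 0 < r \<and> r \<le> R' \<longrightarrow> bohr_cesaro_ineq \<beta> a r))))"
proof (intro conjI allI impI ballI notI)
  show "\<exists>!R. is_bohr_cesaro_radius \<beta> R"
    by (rule bohr_radius_unique[OF assms])
next
  fix f a and r :: real
  assume "f \<in> unit_ball_class" "power_series_on_disk f a" "0 < r \<and> r < 1"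
  then show "summable (\<lambda>n. beta_cesaro_coeff \<beta> a n * r ^ n)"
    using bohr_cesaro_majorant(1)[OF assms] by blast
next
  fix R f a and r :: real
  assume R: "is_bohr_cesaro_radius \<beta> R" and f: "f \<in> unit_ball_class" "power_series_on_disk f a"
    and r: "0 < r \<and> r \<le> R"
  \<comment> \<open>The endpoint r = R is separate: there the gap is zero rather than
    positive.\<close>
  then have "bohr_gap \<beta> r \<ge> 0" "r < 1"
    using bohr_radius_sign(1)[OF assms R, of r] by (cases "r = R"; force simp: is_bohr_cesaro_radius_iff)+
  then show "bohr_cesaro_ineq \<beta> a r"
    using bohr_cesaro_ineq_holds[OF assms _ _ _ f] r by blast
next
  fix R
  assume R: "is_bohr_cesaro_radius \<beta> R" and
    "\<exists>R'. R < R' \<and> R' < 1 \<and> (\<forall>f\<in>unit_ball_class. \<forall>a. power_series_on_disk f a \<longrightarrow>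
               (\<forall>r. 0 < r \<and> r \<le> R' \<longrightarrow> bohr_cesaro_ineq \<beta> a r))"
  then obtain R' where R': "R < R'" "R' < 1" and
    ineq: "\<And>f a r. \<lbrakk>f \<in> unit_ball_class; power_series_on_disk f a; 0 < r; r \<le> R'\<rbrakk> \<Longrightarrow> bohr_cesaro_ineq \<beta> a r"
    by blast
  have "R' > 0" using R R' by (simp add: is_bohr_cesaro_radius_iff)
  \<comment> \<open>The single radius r = R' already gives the contradiction, since the gap is
    negative beyond \<open>R\<close>.\<close>
  then have "bohr_gap \<beta> R' \<ge> 0"
    using R' ineq[OF blaschke_extremal] by (intro bohr_cesaro_ineq_sharp assms) auto
  with bohr_radius_sign(2)[OF assms R, of R'] R' show False by simp
qed

end
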